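(* Let $k\ge2$ be an integer, $q=p^r$ with $p$ prime and $r\ge1$, and let $\beta_0,\dots,\beta_{k-1}\in\mathbb{F}_q$ be arbitrary. For $n\ge k$ let $\sigma_{n,m}$ denote the elementary symmetric polynomial of degree $m$ in $X_1,\dots,X_n$ over $\mathbb{F}_q$. Then the sequence $$\left\{S_{\mathbb{F}_q}\left(\sum_{j=0}^{k-1}\beta_j\sigma_{n,k-j}\right)\right\}_n$$ satisfies a linear recurrence with constant coefficients.
   Context: For $F\in\mathbb{F}_q[X_1,\dots,X_n]$, $S_{\mathbb{F}_q}(F)=\sum_{\mathbf{x}\in\mathbb{F}_q^n}e^{\frac{2\pi i}{p}\mathrm{Tr}_{\mathbb{F}_q/\mathbb{F}_p}(F(\mathbf{x}))}$, with $\mathrm{Tr}_{\mathbb{F}_q/\mathbb{F}_p}$ the field trace. *)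

theory Defs
  imports
    "HOL-Analysis.Analysis"
    "HOL-Library.Poly_Mapping"
    "HOL-Computational_Algebra.Computational_Algebra"
    "HOL-Number_Theory.Cong"
begin

text \<open>
  Polynomials over a commutative ring in the variables $X_0, X_1, \ldots$: finitely supported
  maps from exponent vectors to coefficients, with the convolution product of
  \<^theory>\<open>HOL-Library.Poly_Mapping\<close>. The ring in $X_1, \ldots, X_n$ is the subring of
  polynomials involving only these variables.
\<close>

type_synonym 'a mpol = "(nat \<Rightarrow>\<^sub>0 nat) \<Rightarrow>\<^sub>0 'a"

definition Const :: "'a::comm_ring_1 \<Rightarrow> 'a mpol" where
  "Const a = Poly_Mapping.single 0 a"

definition Var :: "nat \<Rightarrow> 'a::comm_ring_1 mpol" where
  "Var i = Poly_Mapping.single (Poly_Mapping.single i 1) 1"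

definition eval_mpol :: "'a::comm_ring_1 mpol \<Rightarrow> (nat \<Rightarrow> 'a) \<Rightarrow> 'a" where
  "eval_mpol F x = (\<Sum>m\<in>Poly_Mapping.keys F. Poly_Mapping.lookup F m *
     (\<Prod>i\<in>Poly_Mapping.keys m. x i ^ Poly_Mapping.lookup m i))"

definition elem_sym :: "nat \<Rightarrow> nat \<Rightarrow> 'a::comm_ring_1 mpol" where
  "elem_sym n m = (\<Sum>A | A \<subseteq> {1..n} \<and> card A = m. \<Prod>i\<in>A. Var i)"

text \<open>
  The trace of the extension of degree \<open>r\<close> of the field with \<open>p\<close> elements, as the sum
  of the Frobenius conjugates. Its values lie in the prime subfield, i.e. among the
  \<open>of_nat m\<close> with \<open>m < p\<close> (lemma \<open>field_trace_in_prime_subfield\<close>).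
\<close>

definition field_trace :: "nat \<Rightarrow> nat \<Rightarrow> 'a::finite_field \<Rightarrow> 'a" where
  "field_trace p r a = (\<Sum>i<r. a ^ (p ^ i))"

text \<open>
  The least natural number representing an element of the prime subfield; meaningless for
  other elements. The exponential below does not depend on the choice of representative
  modulo \<open>p\<close>.
\<close>

definition prime_subfield_rep :: "'a::finite_field \<Rightarrow> nat" where
  "prime_subfield_rep a = (LEAST m. of_nat m = a)"

text \<open>
  The exponential sum $S_{F_q}(F)$ of \<open>F\<close> as a polynomial in $X_1, \ldots, X_n$, for
  $q = p^r$. The number of variables \<open>n\<close> is a parameter, since it is not determined by
  \<open>F\<close>. Points of $F_q^n$ are the extensional functions on \<open>{1..n}\<close>.
\<close>

definition exp_sum :: "nat \<Rightarrow> nat \<Rightarrow> nat \<Rightarrow> 'a::finite_field mpol \<Rightarrow> complex" where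
  "exp_sum p r n F = (\<Sum>x \<in> {1..n} \<rightarrow>\<^sub>E (UNIV :: 'a set).
     exp (2 * of_real pi * \<i> / of_nat p *
          of_nat (prime_subfield_rep (field_trace p r (eval_mpol F x)))))"

text \<open>
  The sequence $(s_n)_{n \ge n_0}$ satisfies a homogeneous linear recurrence with constant
  coefficients, of some positive order \<open>d\<close> and valid from the first term on.
\<close>

definition satisfies_linear_recurrence_from :: "nat \<Rightarrow> (nat \<Rightarrow> 'b::comm_ring_1) \<Rightarrow> bool" where
  "satisfies_linear_recurrence_from n0 s \<longleftrightarrow>
     (\<exists>d>0. \<exists>c :: nat \<Rightarrow> 'b. \<forall>n\<ge>n0. s (n + d) = (\<Sum>i<d. c i * s (n + i)))"

lemma CHAR_eq_if_card_eq_prime_power: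
  assumes "prime p" "CARD('a::finite_field) = p ^ r"
  shows   "CHAR('a) = p"
proof -
  have "(\<Sum>x\<in>(UNIV :: 'a set). x) = (\<Sum>x\<in>(UNIV :: 'a set). x + 1)"
    by (rule sum.reindex_bij_witness[of _ "\<lambda>x. x + 1" "\<lambda>x. x - 1"]) auto
  hence "of_nat CARD('a) = (0 :: 'a)"
    by (simp add: sum.distrib)
  hence "CHAR('a) dvd p ^ r"
    using assms by (simp only: of_nat_eq_0_iff_char_dvd)
  thus ?thesis
    by (intro primes_dvd_imp_eq CHAR_prime assms(1)) (rule prime_dvd_power[OF CHAR_prime])
qed

lemma field_trace_in_prime_subfield:
  fixes a :: "'a::finite_field"
  assumes p: "prime p" and r: "r \<ge> 1" and card: "CARD('a) = p ^ r"
  shows   "field_trace p r a \<in> of_nat ` {..<p}"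
proof -
  define t where "t = field_trace p r a"
  have char: "CHAR('a) = p"
    using CHAR_eq_if_card_eq_prime_power[OF p card] .
  have "t ^ p = (\<Sum>i<r. (a ^ (p ^ i)) ^ p)"
    unfolding t_def field_trace_def
    by (rule freshmans_dream_sum) (use p char in auto)
  also have "\<dots> = (\<Sum>i<r. a ^ (p ^ Suc i))"
    by (simp only: power_mult [symmetric] power_Suc2)
  also have "\<dots> = (\<Sum>i<r. a ^ (p ^ i)) + a ^ (p ^ r) - a"
  proof -
    have "(\<Sum>i<r. a ^ (p ^ Suc i)) - (\<Sum>i<r. a ^ (p ^ i)) = a ^ (p ^ r) - a"
      using sum_lessThan_telescope[of "\<lambda>i. a ^ (p ^ i)" r]
      by (simp only: sum_subtractf power_0 power_one_right)
    thus ?thesis by (simp only: diff_eq_eq) (simp only: algebra_simps)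
  qed
  also have "a ^ (p ^ r) = a"
    using finite_field_power_card_eq_same[of a] card by simp
  finally have t: "t ^ p = t"
    by (simp add: t_def field_trace_def)
  let ?P = "monom 1 p - monom 1 1 :: 'a poly"
  have p1: "p > 1" using p prime_gt_1_nat by blast
  have "coeff ?P p = 1" using p1 by simp
  hence P0: "?P \<noteq> 0" by (metis coeff_0 zero_neq_one)
  have deg: "degree ?P \<le> p"
    using p1 by (intro degree_diff_le order.trans[OF degree_monom_le]) simp_all
  have roots: "of_nat m \<in> {x. poly ?P x = 0}" for m
  proof -
    have "(of_nat m :: 'a) ^ p = of_nat m"
    proof (induction m)
      case (Suc m)
      have "(1 + of_nat m :: 'a) ^ p = 1 ^ p + of_nat m ^ p"
        by (rule freshmans_dream) (use p char in simp_all)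
      thus ?case by (simp only: of_nat_Suc Suc.IH power_one)
    qed (use p1 in auto)
    thus ?thesis by (simp add: poly_monom)
  qed
  have inj: "inj_on (of_nat :: nat \<Rightarrow> 'a) {..<p}"
    by (rule inj_onI) (simp add: of_nat_eq_iff_cong_CHAR char cong_def)
  have "of_nat ` {..<p} = {x :: 'a. poly ?P x = 0}"
  proof (rule card_seteq)
    show "card {x :: 'a. poly ?P x = 0} \<le> card ((of_nat :: nat \<Rightarrow> 'a) ` {..<p})"
      using card_poly_roots_bound[OF P0] deg inj by (simp add: card_image)
  qed (use roots in auto)
  moreover have "poly ?P t = 0" using t by (simp add: poly_monom)
  ultimately show ?thesis unfolding t_def by blast
qed

end

theory Submission
  imports Defs
begin

text \<open>
  The values of the elementary symmetric polynomials of degree at most \<open>k\<close> at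
  $(x_1, \ldots, x_{n+1})$ depend only on those at $(x_1, \ldots, x_n)$ and on $x_{n+1}$, so they
  are the states of a finite automaton reading $x_1, x_2, \ldots$, and the exponential sum is a sum
  over all words of length \<open>n\<close> of a function of the final state. The vectors counting the words
  that lead to each state are the iterates of a transfer matrix on a finite-dimensional space.
  Hence one of them is a linear combination of its predecessors, and applying powers of the
  matrix turns this relation into a linear recurrence.
\<close>

section \<open>Iterates of a matrix\<close>

text \<open>Gaussian elimination on the coordinates: a vector with nonzero entry at \<open>t\<close>
  clears that coordinate from the others, at the cost of one vector and one coordinate. Indexing by
  \<open>I\<close> lets repeated vectors count as dependent.\<close>

lemma exists_linear_dependence:
  fixes w :: "'i \<Rightarrow> 's \<Rightarrow> 'f::field"
  assumes "finite S" "finite I" "card S < card I"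
  shows "\<exists>c. (\<exists>i\<in>I. c i \<noteq> 0) \<and> (\<forall>t\<in>S. (\<Sum>i\<in>I. c i * w i t) = 0)"
  using assms
proof (induction S arbitrary: I w rule: finite_induct)
  case empty
  then obtain i where "i \<in> I" by fastforce
  then show ?case by (intro exI[of _ "\<lambda>_. 1"]) auto
next
  case (insert t S)
  show ?case
  proof (cases "\<forall>i\<in>I. w i t = 0")
    case True
    have "card S < card I" using insert by simp
    from insert.IH[OF insert.prems(1) this, of w]
    obtain c where c: "\<exists>i\<in>I. c i \<noteq> 0" "\<forall>t\<in>S. (\<Sum>i\<in>I. c i * w i t) = 0" by blast
    moreover have "(\<Sum>i\<in>I. c i * w i t) = 0" using True by simp
    ultimately show ?thesis by (intro exI[of _ c]) simp
  next
    case False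
    then obtain j where j: "j \<in> I" "w j t \<noteq> 0" by blast
    define w' where "w' i u = w i u - w i t / w j t * w j u" for i u
    have "card S < card (I - {j})" using insert j by (simp add: card_Diff_singleton)
    from insert.IH[OF _ this, of w'] insert.prems(1)
    obtain c where c: "\<exists>i\<in>I - {j}. c i \<noteq> 0"
      "\<forall>u\<in>S. (\<Sum>i\<in>I - {j}. c i * w' i u) = 0" by blast
    \<comment> \<open>The coefficient at \<open>j\<close> collects the multiples of
      \<open>w j\<close> subtracted in \<open>w'\<close>, so that \<open>b\<close> combines the
      \<open>w i\<close> exactly as \<open>c\<close> combines the \<open>w' i\<close>.\<close>
    define b where "b = c(j := - (\<Sum>i\<in>I - {j}. c i * (w i t / w j t)))"
    have eq: "(\<Sum>i\<in>I. b i * w i u) = (\<Sum>i\<in>I - {j}. c i * w' i u)" for u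
    proof -
      have "(\<Sum>i\<in>I. b i * w i u) = b j * w j u + (\<Sum>i\<in>I - {j}. b i * w i u)"
        using insert.prems(1) j by (simp add: sum.remove)
      also have "(\<Sum>i\<in>I - {j}. b i * w i u) = (\<Sum>i\<in>I - {j}. c i * w i u)"
        by (intro sum.cong) (auto simp: b_def)
      finally show ?thesis
        by (simp add: b_def w'_def algebra_simps sum_subtractf sum_distrib_left sum_distrib_right)
    qed
    have "w' i t = 0" for i using j by (simp add: w'_def)
    then have "\<forall>u\<in>insert t S. (\<Sum>i\<in>I. b i * w i u) = 0" using c(2) by (simp add: eq)
    moreover have "\<exists>i\<in>I. b i \<noteq> 0" using c(1) by (auto simp: b_def)
    ultimately show ?thesis by blast
  qed
qed

text \<open>One \<open>c\<close> serves all coordinates \<open>t\<close>, so the recurrence passes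
  to any fixed linear combination of coordinates.\<close>

lemma matrix_iterates_linear_recurrence:
  fixes v :: "nat \<Rightarrow> 's \<Rightarrow> 'f::field"
  assumes "finite S"
    and step: "\<And>n t. t \<in> S \<Longrightarrow> v (Suc n) t = (\<Sum>s\<in>S. M s t * v n s)"
  shows "\<exists>d>0. \<exists>c. \<forall>n. \<forall>t\<in>S. v (n + d) t = (\<Sum>i<d. c i * v (n + i) t)"
proof -
  \<comment> \<open>Omitting index 0 forces positive order even when the initial vector vanishes.\<close>
  let ?I = "{1..Suc (card S)}"
  obtain b where b: "\<exists>i\<in>?I. b i \<noteq> 0" "\<forall>t\<in>S. (\<Sum>i\<in>?I. b i * v i t) = 0"
    using exists_linear_dependence[OF \<open>finite S\<close>, of ?I v] by auto
  \<comment> \<open>The last nonzero coefficient, so that the relation can be solved for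
    \<open>v d\<close>.\<close>
  define d where "d = Max {i\<in>?I. b i \<noteq> 0}"
  have "d \<in> {i\<in>?I. b i \<noteq> 0}"
    unfolding d_def by (rule Max_in) (use b(1) in auto)
  then have d: "d \<in> ?I" "b d \<noteq> 0" by auto
  have above: "b i = 0" if "i \<in> ?I" "d < i" for i
    using that Max_ge[of "{i\<in>?I. b i \<noteq> 0}" i] unfolding d_def by fastforce
  \<comment> \<open>The value at 0 is padding: index 0 is absent from the relation, but the sum in
    the recurrence starts there.\<close>
  define c where "c i = (if i = 0 then 0 else - b i / b d)" for i
  have rec: "v (n + d) t = (\<Sum>i<d. c i * v (n + i) t)" if "t \<in> S" for n t
    using that
  proof (induction n arbitrary: t)
    case 0
    have "0 = (\<Sum>i\<in>?I. b i * v i t)" using b(2) 0 by simp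
    also have "\<dots> = (\<Sum>i\<in>{1..d}. b i * v i t)"
      using d above by (intro sum.mono_neutral_right) auto
    also have "{1..d} = insert d {1..<d}" using d by auto
    finally have "b d * v d t = - (\<Sum>i\<in>{1..<d}. b i * v i t)"
      by (simp add: eq_neg_iff_add_eq_0)
    then have "v d t = - (\<Sum>i\<in>{1..<d}. b i * v i t) / b d"
      using d by (simp add: field_simps)
    also have "\<dots> = (\<Sum>i\<in>{1..<d}. c i * v i t)"
      by (simp add: c_def sum_divide_distrib sum_negf)
    also have "\<dots> = (\<Sum>i<d. c i * v i t)"
      by (intro sum.mono_neutral_left) (auto simp: c_def)
    finally show ?case by simp
  next
    case (Suc n)
    \<comment> \<open>The matrix commutes with fixed combinations of iterates, so the relation
      shifts by one. Since it mixes coordinates, the induction hypothesis is applied at every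
      \<open>s\<close>.\<close>
    have "v (Suc n + d) t = (\<Sum>s\<in>S. M s t * (\<Sum>i<d. c i * v (n + i) s))"
      using Suc by (simp add: step)
    also have "\<dots> = (\<Sum>i<d. c i * (\<Sum>s\<in>S. M s t * v (n + i) s))"
      unfolding sum_distrib_left by (subst sum.swap) (simp add: mult_ac)
    finally show ?case using Suc.prems by (simp add: step)
  qed
  moreover have "d > 0" using d by simp
  ultimately show ?thesis by blast
qed

section \<open>Sums over the words read by a finite automaton\<close>

lemma sum_PiE_Suc:
  fixes f :: "(nat \<Rightarrow> 'a) \<Rightarrow> 'b::comm_monoid_add"
  shows "(\<Sum>x\<in>{1..Suc n} \<rightarrow>\<^sub>E A. f x) = (\<Sum>x\<in>{1..n} \<rightarrow>\<^sub>E A. \<Sum>a\<in>A. f (x(Suc n := a)))"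
proof -
  have "(\<Sum>x\<in>{1..Suc n} \<rightarrow>\<^sub>E A. f x)
      = (\<Sum>x\<in>(\<lambda>(a, x). x(Suc n := a)) ` (A \<times> ({1..n} \<rightarrow>\<^sub>E A)). f x)"
    by (simp add: atLeastAtMostSuc_conv PiE_insert_eq)
  also have "\<dots> = (\<Sum>(a, x)\<in>A \<times> ({1..n} \<rightarrow>\<^sub>E A). f (x(Suc n := a)))"
    by (subst sum.reindex[OF inj_combinator]) (auto simp: case_prod_unfold)
  also have "\<dots> = (\<Sum>a\<in>A. \<Sum>x\<in>{1..n} \<rightarrow>\<^sub>E A. f (x(Suc n := a)))"
    by (simp add: sum.cartesian_product)
  finally show ?thesis by (subst sum.swap)
qed

text \<open>The recurrence obtained is valid for every \<open>n\<close>, hence from any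
  \<open>n0\<close> on.\<close>

lemma automaton_sum_linear_recurrence:
  fixes st :: "nat \<Rightarrow> (nat \<Rightarrow> 'a::finite) \<Rightarrow> 's" and \<phi> :: "'s \<Rightarrow> 'f::field"
  assumes "finite S"
    and st_in: "\<And>n x. st n x \<in> S"
    and st_Suc: "\<And>n x a. st (Suc n) (x(Suc n := a)) = step a (st n x)"
  shows "satisfies_linear_recurrence_from n0 (\<lambda>n. \<Sum>x\<in>{1..n} \<rightarrow>\<^sub>E UNIV. \<phi> (st n x))"
proof -
  let ?X = "\<lambda>n. {1..n} \<rightarrow>\<^sub>E (UNIV :: 'a set)"
  define v :: "nat \<Rightarrow> 's \<Rightarrow> 'f" where "v n s = (\<Sum>x\<in>?X n. of_bool (s = st n x))" for n s
  \<comment> \<open>Groups the words by final state. It serves twice: for the transfer step, with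
    \<open>g\<close> counting letters, and for \<open>\<phi>\<close>.\<close>
  have sum_st: "(\<Sum>x\<in>?X n. g (st n x)) = (\<Sum>s\<in>S. g s * v n s)" for g n
  proof -
    have "(\<Sum>s\<in>S. g s * v n s) = (\<Sum>x\<in>?X n. \<Sum>s\<in>S. g s * of_bool (s = st n x))"
      unfolding v_def sum_distrib_left by (rule sum.swap)
    also have "\<dots> = (\<Sum>x\<in>?X n. g (st n x))"
      using \<open>finite S\<close> st_in by (simp add: of_bool_def if_distrib cong: if_cong)
    finally show ?thesis ..
  qed
  \<comment> \<open>The matrix entry counts the letters leading from \<open>s\<close> to
    \<open>t\<close>.\<close>
  have "v (Suc n) t = (\<Sum>s\<in>S. (\<Sum>a\<in>UNIV. of_bool (t = step a s)) * v n s)" for n t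
    unfolding v_def[of "Suc n"] sum_PiE_Suc st_Suc by (rule sum_st)
  from matrix_iterates_linear_recurrence[where v = v, OF \<open>finite S\<close> this]
  obtain d c where d: "d > 0" and
    rec: "\<And>n t. t \<in> S \<Longrightarrow> v (n + d) t = (\<Sum>i<d. c i * v (n + i) t)" by blast
  have "(\<Sum>x\<in>?X (n + d). \<phi> (st (n + d) x))
      = (\<Sum>i<d. c i * (\<Sum>x\<in>?X (n + i). \<phi> (st (n + i) x)))" for n
  proof -
    have "(\<Sum>s\<in>S. \<phi> s * v (n + d) s) = (\<Sum>s\<in>S. \<Sum>i<d. c i * (\<phi> s * v (n + i) s))"
      by (simp add: rec sum_distrib_left mult_ac)
    also have "\<dots> = (\<Sum>i<d. \<Sum>s\<in>S. c i * (\<phi> s * v (n + i) s))" by (rule sum.swap)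
    finally show ?thesis by (simp only: sum_st sum_distrib_left)
  qed
  with d show ?thesis unfolding satisfies_linear_recurrence_from_def by blast
qed

section \<open>Values of elementary symmetric polynomials\<close>

text \<open>Provides a common index set for additivity, since cancellation can remove keys from
  \<open>F + G\<close>.\<close>

lemma eval_mpol_superset:
  assumes "finite B" "Poly_Mapping.keys F \<subseteq> B"
  shows "eval_mpol F x = (\<Sum>m\<in>B. Poly_Mapping.lookup F m *
    (\<Prod>i\<in>Poly_Mapping.keys m. x i ^ Poly_Mapping.lookup m i))"
  unfolding eval_mpol_def using assms
  by (intro sum.mono_neutral_left) (auto simp: in_keys_iff)

lemma eval_mpol_0 [simp]: "eval_mpol 0 x = 0"
  by (simp add: eval_mpol_def)

lemma eval_mpol_add: "eval_mpol (F + G) x = eval_mpol F x + eval_mpol G x"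
proof -
  let ?B = "Poly_Mapping.keys F \<union> Poly_Mapping.keys G"
  have "Poly_Mapping.keys (F + G) \<subseteq> ?B" by (rule Poly_Mapping.keys_add)
  then show ?thesis
    by (simp add: eval_mpol_superset[of ?B] lookup_add algebra_simps sum.distrib)
qed

lemma eval_mpol_sum: "eval_mpol (\<Sum>a\<in>A. F a) x = (\<Sum>a\<in>A. eval_mpol (F a) x)"
  by (induction A rule: infinite_finite_induct) (auto simp: eval_mpol_add)

lemma eval_mpol_single:
  "eval_mpol (Poly_Mapping.single m c) x =
     c * (\<Prod>i\<in>Poly_Mapping.keys m. x i ^ Poly_Mapping.lookup m i)"
  by (simp add: eval_mpol_def)

lemma prod_Var:
  "(\<Prod>i\<in>A. Var i :: 'a::comm_ring_1 mpol)
     = Poly_Mapping.single (\<Sum>i\<in>A. Poly_Mapping.single i 1) 1"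
  by (induction A rule: infinite_finite_induct) (auto simp: Var_def mult_single)

text \<open>All monomials of \<open>elem_sym\<close> are squarefree, so this case and additivity
  determine its values.\<close>

lemma eval_mpol_Const_mult_prod_Var:
  assumes "finite A"
  shows "eval_mpol (Const c * (\<Prod>i\<in>A. Var i)) x = c * (\<Prod>i\<in>A. x i)"
proof -
  let ?m = "\<Sum>i\<in>A. Poly_Mapping.single i (1 :: nat)"
  have lookup: "Poly_Mapping.lookup ?m i = of_bool (i \<in> A)" for i
    using assms by (simp add: lookup_sum lookup_single when_def)
  have "Poly_Mapping.keys ?m = A" by (auto simp: in_keys_iff lookup simp del: One_nat_def)
  then show ?thesis
    by (simp add: prod_Var Const_def mult_single eval_mpol_single lookup del: One_nat_def)
qed

text \<open>The degree comes last so that \<open>esym n x\<close>, as a function of the degree, can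
  become the automaton state.\<close>

definition esym :: "nat \<Rightarrow> (nat \<Rightarrow> 'a::comm_ring_1) \<Rightarrow> nat \<Rightarrow> 'a" where
  "esym n x m = (\<Sum>A | A \<subseteq> {1..n} \<and> card A = m. \<Prod>i\<in>A. x i)"

lemma eval_mpol_Const_mult_elem_sym:
  "eval_mpol (Const c * elem_sym n m) x = c * esym n x m"
  unfolding elem_sym_def esym_def sum_distrib_left eval_mpol_sum
  by (intro sum.cong refl eval_mpol_Const_mult_prod_Var) (auto intro: finite_subset)

lemma esym_0: "esym n x 0 = 1"
proof -
  have "{A. A \<subseteq> {1..n} \<and> card A = 0} = {{}}"
    by (auto simp: card_eq_0_iff dest: finite_subset)
  then show ?thesis by (simp add: esym_def)
qed

text \<open>Subsets of \<open>{1..Suc n}\<close> either avoid \<open>Suc n\<close> or arise by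
  inserting it into a subset of \<open>{1..n}\<close>, which contributes the factor
  \<open>a\<close>.\<close>

lemma esym_Suc_Suc:
  "esym (Suc n) (x(Suc n := a)) (Suc m) = esym n x (Suc m) + a * esym n x m"
proof -
  let ?y = "x(Suc n := a)"
  let ?P = "\<lambda>m. {A. A \<subseteq> {1..n} \<and> card A = m}"
  have fin: "finite (?P m)" for m by (rule finite_subset[of _ "Pow {1..n}"]) auto
  have notin: "Suc n \<notin> A" "finite A" if "A \<in> ?P m" for A m
    using that by (auto intro: finite_subset)
  have same: "(\<Prod>i\<in>A. ?y i) = (\<Prod>i\<in>A. x i)" if "A \<in> ?P m" for A m
    using notin(1)[OF that] by (intro prod.cong) auto
  have split: "{A. A \<subseteq> {1..Suc n} \<and> card A = Suc m} = ?P (Suc m) \<union> insert (Suc n) ` ?P m"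
  proof (intro equalityI subsetI)
    fix A assume A: "A \<in> {A. A \<subseteq> {1..Suc n} \<and> card A = Suc m}"
    then have "finite A" by (auto intro: finite_subset)
    show "A \<in> ?P (Suc m) \<union> insert (Suc n) ` ?P m"
    proof (cases "Suc n \<in> A")
      case True
      then have "A - {Suc n} \<in> ?P m"
        using A \<open>finite A\<close> by (auto simp: atLeastAtMostSuc_conv)
      moreover have "A = insert (Suc n) (A - {Suc n})" using True by blast
      ultimately show ?thesis by blast
    next
      case False
      then show ?thesis using A by (auto simp: atLeastAtMostSuc_conv)
    qed
  next
    fix A assume "A \<in> ?P (Suc m) \<union> insert (Suc n) ` ?P m"
    then consider "A \<in> ?P (Suc m)" | B where "B \<in> ?P m" "A = insert (Suc n) B" by blast
    then show "A \<in> {A. A \<subseteq> {1..Suc n} \<and> card A = Suc m}"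
    proof cases
      case 1
      then show ?thesis by auto
    next
      case 2
      with notin[OF 2(1)] show ?thesis by auto
    qed
  qed
  have inj: "inj_on (insert (Suc n)) (?P m)"
  proof (rule inj_onI)
    fix A B assume A: "A \<in> ?P m" and B: "B \<in> ?P m" and "insert (Suc n) A = insert (Suc n) B"
    then show "A = B" using insert_ident[OF notin(1)[OF A] notin(1)[OF B]] by simp
  qed
  have "esym (Suc n) ?y (Suc m)
      = (\<Sum>A\<in>?P (Suc m). \<Prod>i\<in>A. ?y i) + (\<Sum>A\<in>insert (Suc n) ` ?P m. \<Prod>i\<in>A. ?y i)"
    unfolding esym_def split by (intro sum.union_disjoint fin finite_imageI) auto
  also have "(\<Sum>A\<in>?P (Suc m). \<Prod>i\<in>A. ?y i) = esym n x (Suc m)"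
    unfolding esym_def by (intro sum.cong same refl)
  also have "(\<Sum>A\<in>insert (Suc n) ` ?P m. \<Prod>i\<in>A. ?y i) = (\<Sum>A\<in>?P m. a * (\<Prod>i\<in>A. x i))"
    unfolding sum.reindex[OF inj] o_def
  proof (rule sum.cong)
    fix A assume A: "A \<in> ?P m"
    show "(\<Prod>i\<in>insert (Suc n) A. ?y i) = a * (\<Prod>i\<in>A. x i)"
      using notin[OF A] same[OF A] by simp
  qed simp
  finally show ?thesis by (simp add: esym_def sum_distrib_left)
qed

theorem theorem4p2:
  fixes k p r :: nat and \<beta> :: "nat \<Rightarrow> 'a::finite_field"
  assumes "k \<ge> 2" and "prime p" and "r \<ge> 1" and "CARD('a) = p ^ r"
  shows "satisfies_linear_recurrence_from k
           (\<lambda>n. exp_sum p r n (\<Sum>j<k. Const (\<beta> j) * elem_sym n (k - j)))"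
proof -
  \<comment> \<open>Restriction makes the states extensional functions from a finite set to a finite
    field, so there are finitely many.\<close>
  define st :: "nat \<Rightarrow> (nat \<Rightarrow> 'a) \<Rightarrow> nat \<Rightarrow> 'a"
    where "st n x = restrict (esym n x) {..k}" for n x
  \<comment> \<open>Degree \<open>m\<close> is updated from degrees \<open>m\<close> and
    \<open>m - 1\<close> only, so truncation at \<open>k\<close> is consistent; degree 0 is
    constantly 1.\<close>
  define step :: "'a \<Rightarrow> (nat \<Rightarrow> 'a) \<Rightarrow> nat \<Rightarrow> 'a"
    where "step a s = (\<lambda>m\<in>{..k}. case m of 0 \<Rightarrow> 1 | Suc l \<Rightarrow> s m + a * s l)" for a s
  \<comment> \<open>For \<open>j < k\<close> the degree \<open>k - j\<close> lies in
    \<open>{..k}\<close>, so the state determines the summand.\<close>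
  define \<phi> :: "(nat \<Rightarrow> 'a) \<Rightarrow> complex" where "\<phi> s = exp (2 * of_real pi * \<i> / of_nat p *
    of_nat (prime_subfield_rep (field_trace p r (\<Sum>j<k. \<beta> j * s (k - j)))))" for s
  have "exp_sum p r n (\<Sum>j<k. Const (\<beta> j) * elem_sym n (k - j))
      = (\<Sum>x\<in>{1..n} \<rightarrow>\<^sub>E UNIV. \<phi> (st n x))" for n
    by (simp add: exp_sum_def \<phi>_def st_def eval_mpol_sum eval_mpol_Const_mult_elem_sym)
  moreover have "satisfies_linear_recurrence_from k (\<lambda>n. \<Sum>x\<in>{1..n} \<rightarrow>\<^sub>E UNIV. \<phi> (st n x))"
  proof (rule automaton_sum_linear_recurrence[where S = "{..k} \<rightarrow>\<^sub>E UNIV" and step = step])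
    show "finite ({..k} \<rightarrow>\<^sub>E (UNIV :: 'a set))" by (intro finite_PiE) auto
    show "st n x \<in> {..k} \<rightarrow>\<^sub>E UNIV" for n x by (simp add: st_def)
    show "st (Suc n) (x(Suc n := a)) = step a (st n x)" for n x a
      by (auto simp: st_def step_def esym_0 esym_Suc_Suc fun_eq_iff split: nat.split)
  qed
  ultimately show ?thesis by simp
qed

end
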